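(* Let $g:\mathbb{R}^d\to[0,\infty)$ be a risk function, $\alpha\in(0,1)$, $\lambda>0$, $L>0$, and let $\mathcal{Q}^g:=\{Q\in\mathcal{P}(\mathbb{R}^d):\mathbb{E}_Q[g]<\infty\}$. Let $P$ be the target distribution, and let the following assumption hold: (1) $Q,P\in\mathcal{Q}^g$, so that the CVaR discrepancy below is well-defined; (2) $Q$ has finite first moment, so that the Lipschitz-regularized KL divergence $D^L_{\mathrm{KL}}(Q\|P)$ is well-defined. Then the loss functional $$\mathcal{F}(Q;P)=D^L_{\mathrm{KL}}(Q\|P)+\lambda\big(\mathrm{CVaR}_\alpha^{P,g}-\mathrm{CVaR}_\alpha^{Q,g}\big)^2$$ satisfies $\mathcal{F}(Q;P)\ge0$ for all $Q\in\mathcal{Q}^g$, and $\mathcal{F}(Q;P)=0$ if and only if $Q=P$. That is, $P$ is the unique global minimizer of the optimization problem $\inf_{Q\in\mathcal{Q}^g}\mathcal{F}(Q;P)$.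
   Context: $\mathcal{P}(\mathbb{R}^d)$ is the set of probability measures on $\mathbb{R}^d$. The finite-first-moment requirement in (2) is a standing assumption on the measures $Q$ at which $\mathcal{F}(\cdot;P)$ is considered. The Lipschitz-regularized KL divergence is $D^L_{\mathrm{KL}}(Q\|P)=\inf_{\gamma\in\mathcal{P}(\mathbb{R}^d)}\{D_{\mathrm{KL}}(\gamma\|P)+L\,\mathcal{W}_1(Q,\gamma)\}$, where $D_{\mathrm{KL}}$ is the Kullback–Leibler divergence and $\mathcal{W}_1$ is the Wasserstein-1 metric. CVaR. For $Q\in\mathcal{Q}^g$, the Conditional Value-at-Risk of $g$ under $Q$ at level $\alpha$ is $\mathrm{CVaR}_\alpha^{Q,g}=\inf_{y\in\mathbb{R}}\{y+\frac{1}{1-\alpha}\mathbb{E}_Q[(g-y)^+]\}$. *)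

theory Defs
  imports "HOL-Probability.Probability"
begin

definition prob_measures :: "(real ^ 'n) measure set" where
  "prob_measures = {M. prob_space M \<and> sets M = sets borel}"

definition finite_risk :: "(real ^ 'n \<Rightarrow> real) \<Rightarrow> (real ^ 'n) measure set" where
  "finite_risk g = {Q \<in> prob_measures. (\<integral>\<^sup>+ x. ennreal (g x) \<partial>Q) < \<infinity>}"

definition finite_first_moment :: "(real ^ 'n) measure \<Rightarrow> bool" where
  "finite_first_moment Q \<longleftrightarrow> (\<integral>\<^sup>+ x. ennreal (norm x) \<partial>Q) < \<infinity>"

(* KL_div Q P is D_KL(Q || P) with the natural logarithm; the library's KL_divergence takes the
   reference measure first and is real-valued, returning 0 when the integral diverges.  For
   probability measures with Q << P the negative part of log (dQ/dP) is always Q-integrable, so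
   non-integrability means that the integral is +infinity. *)
definition KL_div :: "(real ^ 'n) measure \<Rightarrow> (real ^ 'n) measure \<Rightarrow> ereal" where
  "KL_div Q P =
    (if absolutely_continuous P Q \<and> integrable Q (entropy_density (exp 1) P Q)
     then ereal (KL_divergence (exp 1) P Q) else \<infinity>)"

definition couplings ::
  "(real ^ 'n) measure \<Rightarrow> (real ^ 'n) measure \<Rightarrow> ((real ^ 'n) \<times> (real ^ 'n)) measure set" where
  "couplings Q R = {\<pi>. prob_space \<pi> \<and> sets \<pi> = sets (borel \<Otimes>\<^sub>M borel) \<and>
     distr \<pi> borel fst = Q \<and> distr \<pi> borel snd = R}"

definition wasserstein1 :: "(real ^ 'n) measure \<Rightarrow> (real ^ 'n) measure \<Rightarrow> ennreal" where
  "wasserstein1 Q R = (INF \<pi> \<in> couplings Q R. \<integral>\<^sup>+ z. ennreal (dist (fst z) (snd z)) \<partial>\<pi>)"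

definition lip_KL :: "real \<Rightarrow> (real ^ 'n) measure \<Rightarrow> (real ^ 'n) measure \<Rightarrow> ereal" where
  "lip_KL L Q P =
    (INF \<gamma> \<in> prob_measures. KL_div \<gamma> P + ereal L * enn2ereal (wasserstein1 Q \<gamma>))"

(* For 0 < \<alpha> < 1, g >= 0 and Q in finite_risk g the integrals exist and the infimum is over a
   set of reals bounded below by 0. *)
definition CVaR :: "real \<Rightarrow> (real ^ 'n) measure \<Rightarrow> (real ^ 'n \<Rightarrow> real) \<Rightarrow> real" where
  "CVaR \<alpha> Q g = (INF y::real. y + 1 / (1 - \<alpha>) * (\<integral> x. max (g x - y) 0 \<partial>Q))"

definition loss ::
  "(real ^ 'n \<Rightarrow> real) \<Rightarrow> real \<Rightarrow> real \<Rightarrow> real \<Rightarrow>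
    (real ^ 'n) measure \<Rightarrow> (real ^ 'n) measure \<Rightarrow> ereal" where
  "loss g \<alpha> l L Q P = lip_KL L Q P + ereal (l * (CVaR \<alpha> P g - CVaR \<alpha> Q g)\<^sup>2)"

end

theory Submission
  imports Defs
begin

text \<open>
  Testing against a Lipschitz \<open>f\<close> with values in \<open>[0, 1]\<close>, the Gibbs variational inequality for the
  function \<open>t f\<close> gives \<open>E\<^sub>\<gamma> f - E\<^sub>P f \<le> KL(\<gamma>, P)/t + t\<close> for every
  \<open>t \<in> (0, 1]\<close>, and a coupling of \<open>Q\<close> and \<open>\<gamma>\<close> gives \<open>E\<^sub>Q f - E\<^sub>\<gamma> f \<le> K W\<^sub>1(Q, \<gamma>)\<close>.  If the infimum
  defining the regularized divergence is zero, both right-hand sides can be made arbitrarily small, so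
  \<open>E\<^sub>Q f \<le> E\<^sub>P f\<close>; the same for \<open>1 - f\<close> gives equality, and Lipschitz functions determine a
  probability measure.
\<close>

section \<open>Variational bounds for the Kullback-Leibler divergence\<close>

text \<open>Fenchel-Young inequality for the conjugate pair h ln h - h and exp s. For positive h it
  is ln u <= u - 1 at u = exp s / h, multiplied by h.\<close>

lemma mult_le_entropy_plus_exp:
  fixes h s :: real
  assumes "0 \<le> h"
  shows "h * s \<le> h * ln h - h + exp s"
proof (cases "h = 0")
  case False
  then have h: "0 < h" using assms by simp
  have "ln (exp s / h) \<le> exp s / h - 1"
    using h by (intro ln_le_minus_one) simp
  then have "s - ln h \<le> exp s / h - 1"
    using h by (simp add: ln_div)
  then have "h * (s - ln h) \<le> h * (exp s / h - 1)"
    using h by (intro mult_left_mono) auto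
  then show ?thesis
    using h by (simp add: algebra_simps)
qed simp

text \<open>Integrate the pointwise inequality against \<open>M\<close>, with h the density of
  \<open>N\<close>; the term -h contributes -1. This is the Donsker-Varadhan bound with ln E
  replaced by the larger E - 1, which loses little for small \<open>s\<close>.\<close>

lemma (in prob_space) KL_divergence_variational:
  fixes s :: "'a \<Rightarrow> real"
  assumes "prob_space N" and ac: "absolutely_continuous M N" and sets: "sets N = sets M"
    and int: "integrable N (entropy_density (exp 1) M N)"
    and s[measurable]: "s \<in> borel_measurable M" and bounded: "\<And>x. \<bar>s x\<bar> \<le> B"
  shows "(\<integral>x. s x \<partial>N) \<le> KL_divergence (exp 1) M N - 1 + (\<integral>x. exp (s x) \<partial>M)"
proof -
  interpret N: prob_space N by fact
  have "finite_measure N" by unfold_locales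
  from real_RN_deriv[OF this ac sets] obtain D where
    D: "D \<in> borel_measurable M" "AE x in M. RN_deriv M N x = ennreal (D x)" "\<And>x. 0 \<le> D x"
    by this auto
  note [measurable] = D(1)
  have "N = density M (RN_deriv M N)"
    using ac sets by (rule density_RN_deriv[symmetric])
  also have "\<dots> = density M D"
    using D by (auto intro!: density_cong)
  finally have N: "N = density M D" .
  have meas: "entropy_density (exp 1) M N \<in> borel_measurable M"
    unfolding entropy_density_def comp_def log_def by measurable
  \<comment> \<open>With base \<open>exp 1\<close> the entropy density is the natural logarithm of
    the derivative; \<open>D\<close> is only an almost everywhere version of it.\<close>
  have ae: "AE x in M. D x * entropy_density (exp 1) M N x = D x * ln (D x)"
    using D(2) by eventually_elim (simp add: entropy_density_def log_def D(3))
  have "integrable M (\<lambda>x. D x * entropy_density (exp 1) M N x)"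
    using int meas D by (subst (asm) (1) N) (simp add: integrable_real_density)
  then have int_ent: "integrable M (\<lambda>x. D x * ln (D x))"
    using ae meas by (subst (asm) integrable_cong_AE[OF _ _ ae]) auto
  have "KL_divergence (exp 1) M N = (\<integral>x. entropy_density (exp 1) M N x \<partial>density M D)"
    unfolding KL_divergence_def N[symmetric] by simp
  also have "\<dots> = (\<integral>x. D x * entropy_density (exp 1) M N x \<partial>M)"
    using meas D by (intro integral_real_density) auto
  also have "\<dots> = (\<integral>x. D x * ln (D x) \<partial>M)"
    using ae meas by (intro integral_cong_AE) auto
  finally have KL: "KL_divergence (exp 1) M N = (\<integral>x. D x * ln (D x) \<partial>M)" .
  have "integrable N (\<lambda>x. 1 :: real)" by simp
  then have int_D: "integrable M D"
    using D by (simp add: N integrable_real_density)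
  have "(\<integral>x. 1 \<partial>N) = (\<integral>x. D x * 1 \<partial>M)"
    unfolding N using D by (intro integral_real_density) auto
  then have D1: "(\<integral>x. D x \<partial>M) = 1"
    using N.prob_space by simp
  have s_N: "s \<in> borel_measurable N"
    using s sets by (simp cong: measurable_cong_sets)
  have "integrable N s"
    using bounded s_N by (intro N.integrable_const_bound[where B=B]) auto
  then have int_s: "integrable M (\<lambda>x. D x * s x)"
    using D by (simp add: N integrable_real_density)
  have int_exp: "integrable M (\<lambda>x. exp (s x))"
    using bounded by (intro integrable_const_bound[where B="exp B"]) (auto intro: abs_le_D1)
  have "(\<integral>x. s x \<partial>N) = (\<integral>x. D x * s x \<partial>M)"
    unfolding N using D by (intro integral_real_density) auto
  also have "\<dots> \<le> (\<integral>x. D x * ln (D x) - D x + exp (s x) \<partial>M)"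
    using int_s int_ent int_D int_exp D(3) by (intro integral_mono) (auto intro: mult_le_entropy_plus_exp)
  also have "\<dots> = KL_divergence (exp 1) M N - 1 + (\<integral>x. exp (s x) \<partial>M)"
    using int_ent int_D int_exp by (simp add: KL D1)
  finally show ?thesis .
qed

text \<open>For the test function 0 the exponential integrates to 1 and cancels the -1.\<close>

lemma (in prob_space) KL_divergence_nonneg:
  assumes "prob_space N" "absolutely_continuous M N" "sets N = sets M"
    "integrable N (entropy_density (exp 1) M N)"
  shows "0 \<le> KL_divergence (exp 1) M N"
  using KL_divergence_variational[OF assms, of "\<lambda>_. 0" 0] by (simp add: prob_space)

text \<open>The test function is t f; a second-order bound on its exponential moment followed by
  division by \<open>t\<close> gives the claim. Keeping \<open>t\<close> free lets it be matched to
  the size of the divergence, in place of Pinsker's inequality.\<close>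

lemma (in prob_space) expectation_diff_le_KL_divergence:
  fixes f :: "'a \<Rightarrow> real"
  assumes N: "prob_space N" "absolutely_continuous M N" "sets N = sets M"
    "integrable N (entropy_density (exp 1) M N)"
    and f[measurable]: "f \<in> borel_measurable M" and f01: "\<And>x. 0 \<le> f x" "\<And>x. f x \<le> 1"
    and t: "0 < t" "t \<le> 1"
  shows "(\<integral>x. f x \<partial>N) - (\<integral>x. f x \<partial>M) \<le> KL_divergence (exp 1) M N / t + t"
proof -
  have tf: "0 \<le> t * f x" "t * f x \<le> 1" "t * f x \<le> t" for x
    using t f01[of x] by (auto intro: mult_le_one simp: mult_left_le)
  have int_f: "integrable M f"
    using f01 by (intro integrable_const_bound[where B=1]) auto
  \<comment> \<open>The bound exp u <= 1 + u + u^2 holds on [0, 1], where t f takes its values; then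
    (t f)^2 is at most t^2, uniformly in \<open>x\<close>.\<close>
  have exp_le: "exp (t * f x) \<le> 1 + t * f x + t\<^sup>2" for x
    using exp_bound[OF tf(1,2)[of x]] power_mono[OF tf(3,1)[of x], of 2] by linarith
  have int_exp: "integrable M (\<lambda>x. exp (t * f x))"
    using tf by (intro integrable_const_bound[where B="exp 1"]) auto
  have "t * (\<integral>x. f x \<partial>N) \<le> KL_divergence (exp 1) M N - 1 + (\<integral>x. exp (t * f x) \<partial>M)"
    using KL_divergence_variational[OF N, of "\<lambda>x. t * f x" 1] tf by simp
  also have "(\<integral>x. exp (t * f x) \<partial>M) \<le> (\<integral>x. 1 + t * f x + t\<^sup>2 \<partial>M)"
    using int_exp int_f exp_le by (intro integral_mono) auto
  also have "\<dots> = 1 + t * (\<integral>x. f x \<partial>M) + t\<^sup>2"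
    using int_f by (simp add: prob_space)
  finally have "t * ((\<integral>x. f x \<partial>N) - (\<integral>x. f x \<partial>M)) \<le> KL_divergence (exp 1) M N + t\<^sup>2"
    by (simp add: algebra_simps)
  then have "(\<integral>x. f x \<partial>N) - (\<integral>x. f x \<partial>M) \<le> (KL_divergence (exp 1) M N + t\<^sup>2) / t"
    using t by (simp add: pos_le_divide_eq mult.commute)
  then show ?thesis
    using t by (simp add: add_divide_distrib power2_eq_square)
qed

section \<open>Divergence and transport cost separately\<close>

lemma KL_div_nonneg:
  assumes "\<gamma> \<in> prob_measures" "P \<in> prob_measures"
  shows "0 \<le> KL_div \<gamma> P"
proof -
  interpret P: prob_space P using assms by (simp add: prob_measures_def)
  show ?thesis
    using P.KL_divergence_nonneg[of \<gamma>] assms by (auto simp: KL_div_def prob_measures_def)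
qed

lemma KL_div_self:
  assumes "P \<in> prob_measures"
  shows "KL_div P P = 0"
proof -
  interpret P: prob_space P using assms by (simp add: prob_measures_def)
  \<comment> \<open>The constant 1 is a density of \<open>P\<close> with respect to itself, so the
    logarithm vanishes almost everywhere. This supplies the integrability on which
    \<open>KL_div\<close> branches; otherwise its value would be infinite.\<close>
  have "AE x in P. 1 = RN_deriv P P x"
    by (rule P.RN_deriv_unique) (auto simp: density_1)
  then have ae: "AE x in P. 0 = entropy_density (exp 1) P P x"
    by eventually_elim (auto simp: entropy_density_def simp flip: one_ennreal.rep_eq)
  have "entropy_density (exp 1) P P \<in> borel_measurable P"
    unfolding entropy_density_def comp_def log_def by measurable
  then have "integrable P (entropy_density (exp 1) P P)"
    using integrable_cong_AE[OF _ _ ae] by simp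
  moreover have "absolutely_continuous P P"
    by (simp add: absolutely_continuous_def)
  ultimately show ?thesis
    by (simp add: KL_div_def P.KL_same_eq_0 zero_ereal_def)
qed

lemma wasserstein1_self:
  fixes P :: "(real ^ 'n) measure"
  assumes "P \<in> prob_measures"
  shows "wasserstein1 P P = 0"
proof -
  interpret P: prob_space P using assms by (simp add: prob_measures_def)
  have [measurable_cong]: "sets P = sets borel"
    using assms by (simp add: prob_measures_def)
  \<comment> \<open>The diagonal coupling moves no mass.\<close>
  let ?\<pi> = "distr P (borel \<Otimes>\<^sub>M borel) (\<lambda>x. (x, x))"
  have "distr P borel (\<lambda>x. x) = P"
    using distr_id2[of borel P] assms by (simp add: prob_measures_def)
  then have "?\<pi> \<in> couplings P P"
    unfolding couplings_def by (auto intro!: P.prob_space_distr simp: distr_distr comp_def)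
  moreover have "(\<integral>\<^sup>+ z. ennreal (dist (fst z) (snd z)) \<partial>?\<pi>) = 0"
    by (subst nn_integral_distr) auto
  ultimately have "wasserstein1 P P \<le> 0"
    unfolding wasserstein1_def by (metis (no_types, lifting) INF_lower)
  then show ?thesis by simp
qed

text \<open>The easy half of Kantorovich-Rubinstein duality. It is stated for a single coupling of
  cost at most \<open>r\<close>, since near-optimal couplings are what the infimum in
  \<open>wasserstein1\<close> provides.\<close>

lemma expectation_diff_le_transport_cost:
  fixes f :: "real ^ 'n \<Rightarrow> real"
  assumes \<pi>: "\<pi> \<in> couplings Q R"
    and cost: "(\<integral>\<^sup>+ z. ennreal (dist (fst z) (snd z)) \<partial>\<pi>) \<le> ennreal r" and "0 \<le> r"
    and f[measurable]: "f \<in> borel_measurable borel" and f01: "\<And>x. 0 \<le> f x" "\<And>x. f x \<le> 1"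
    and lip: "\<And>x y. f x - f y \<le> K * dist x y" and "0 \<le> K"
  shows "(\<integral>x. f x \<partial>Q) - (\<integral>x. f x \<partial>R) \<le> K * r"
proof -
  interpret prob_space \<pi> using \<pi> by (simp add: couplings_def)
  have [measurable_cong]: "sets \<pi> = sets (borel \<Otimes>\<^sub>M borel)"
    using \<pi> by (simp add: couplings_def)
  have Q: "Q = distr \<pi> borel fst" and R: "R = distr \<pi> borel snd"
    using \<pi> by (auto simp: couplings_def)
  have int: "integrable \<pi> (\<lambda>z. f (fst z))" "integrable \<pi> (\<lambda>z. f (snd z))"
    using f01 by (auto intro!: integrable_const_bound[where B=1])
  have "(\<integral>x. f x \<partial>Q) - (\<integral>x. f x \<partial>R) = (\<integral>z. f (fst z) - f (snd z) \<partial>\<pi>)"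
    unfolding Q R using int by (simp add: integral_distr)
  also have "\<dots> \<le> K * r"
  proof (rule integral_real_bounded)
    \<comment> \<open>\<open>ennreal\<close> sends negative values to 0, so this bounds the positive
      part of the integrand, which suffices for an upper bound on the real integral.\<close>
    have "(\<integral>\<^sup>+ z. ennreal (f (fst z) - f (snd z)) \<partial>\<pi>)
        \<le> (\<integral>\<^sup>+ z. ennreal K * ennreal (dist (fst z) (snd z)) \<partial>\<pi>)"
      using lip \<open>0 \<le> K\<close> by (intro nn_integral_mono) (simp add: ennreal_leI flip: ennreal_mult)
    also have "\<dots> = ennreal K * (\<integral>\<^sup>+ z. ennreal (dist (fst z) (snd z)) \<partial>\<pi>)"
      by (intro nn_integral_cmult) measurable
    also have "\<dots> \<le> ennreal K * ennreal r"
      using cost by (intro mult_left_mono) auto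
    finally show "(\<integral>\<^sup>+ z. ennreal (f (fst z) - f (snd z)) \<partial>\<pi>) \<le> ennreal (K * r)"
      using \<open>0 \<le> K\<close> \<open>0 \<le> r\<close> by (simp add: ennreal_mult)
  qed (use \<open>0 \<le> K\<close> \<open>0 \<le> r\<close> in simp)
  finally show ?thesis .
qed

section \<open>The Lipschitz-regularized divergence and its zeros\<close>

lemma lip_KL_nonneg:
  assumes "P \<in> prob_measures" "0 \<le> L"
  shows "0 \<le> lip_KL L Q P"
  unfolding lip_KL_def using assms
  by (intro INF_greatest add_nonneg_nonneg KL_div_nonneg mult_nonneg_nonneg) auto

lemma lip_KL_self:
  assumes "P \<in> prob_measures" "0 \<le> L"
  shows "lip_KL L P P = 0"
proof (rule antisym)
  \<comment> \<open>The choice \<gamma> = P makes both terms vanish.\<close>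
  have "lip_KL L P P \<le> KL_div P P + ereal L * enn2ereal (wasserstein1 P P)"
    unfolding lip_KL_def using assms(1) by (rule INF_lower)
  then show "lip_KL L P P \<le> 0"
    using assms by (simp add: KL_div_self wasserstein1_self zero_ennreal.rep_eq)
qed (use assms in \<open>rule lip_KL_nonneg\<close>)

lemma lip_KL_eq_0_imp_expectation_le:
  fixes f :: "real ^ 'n \<Rightarrow> real"
  assumes P: "P \<in> prob_measures" and "0 < L" and zero: "lip_KL L Q P = 0"
    and f[measurable]: "f \<in> borel_measurable borel" and f01: "\<And>x. 0 \<le> f x" "\<And>x. f x \<le> 1"
    and lip: "\<And>x y. f x - f y \<le> K * dist x y" and "0 \<le> K"
  shows "(\<integral>x. f x \<partial>Q) \<le> (\<integral>x. f x \<partial>P)"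
proof -
  interpret P: prob_space P using P by (simp add: prob_measures_def)
  have bound: "(\<integral>x. f x \<partial>Q) - (\<integral>x. f x \<partial>P) \<le> t * (K / L + 2)" if t: "0 < t" "t \<le> 1" for t
  proof -
    \<comment> \<open>The tolerance t^2 is chosen for the estimate KL/t + t: after division by
      \<open>t\<close> an error of order \<open>t\<close> remains. As both terms are nonnegative,
      each lies below t^2.\<close>
    have "lip_KL L Q P < ereal (t\<^sup>2)"
      using zero t by simp
    then obtain \<gamma> where \<gamma>: "\<gamma> \<in> prob_measures"
      and less: "KL_div \<gamma> P + ereal L * enn2ereal (wasserstein1 Q \<gamma>) < ereal (t\<^sup>2)"
      unfolding lip_KL_def INF_less_iff by blast
    have KL0: "0 \<le> KL_div \<gamma> P" by (intro KL_div_nonneg \<gamma> P)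
    have "0 \<le> ereal L * enn2ereal (wasserstein1 Q \<gamma>)"
      using \<open>0 < L\<close> by simp
    then have KL_less: "KL_div \<gamma> P < ereal (t\<^sup>2)"
      using less KL0 by (metis add_increasing2 le_less_trans order_refl)
    have W_less: "ereal L * enn2ereal (wasserstein1 Q \<gamma>) < ereal (t\<^sup>2)"
      using less KL0 by (metis add_increasing le_less_trans order_refl)
    \<comment> \<open>A finite value excludes the infinite branch of \<open>KL_div\<close>, which
      yields absolute continuity and integrability.\<close>
    have ac: "absolutely_continuous P \<gamma>" "integrable \<gamma> (entropy_density (exp 1) P \<gamma>)"
      and KL: "KL_divergence (exp 1) P \<gamma> < t\<^sup>2"
      using KL_less by (auto simp: KL_div_def split: if_splits)
    have "(\<integral>x. f x \<partial>\<gamma>) - (\<integral>x. f x \<partial>P) \<le> KL_divergence (exp 1) P \<gamma> / t + t"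
      using \<gamma> P ac f01 t
      by (intro P.expectation_diff_le_KL_divergence) (auto simp: prob_measures_def cong: measurable_cong_sets)
    also have "KL_divergence (exp 1) P \<gamma> / t \<le> t\<^sup>2 / t"
      using KL t by (intro divide_right_mono) auto
    finally have 1: "(\<integral>x. f x \<partial>\<gamma>) - (\<integral>x. f x \<partial>P) \<le> 2 * t"
      using t by (simp add: power2_eq_square)
    have "wasserstein1 Q \<gamma> < ennreal (t\<^sup>2 / L)"
    proof (cases "wasserstein1 Q \<gamma>")
      case (real w)
      then show ?thesis
        using W_less \<open>0 < L\<close>
        by (simp add: enn2ereal_ennreal ennreal_less_iff pos_less_divide_eq mult.commute)
    next
      case top
      then show ?thesis
        using W_less \<open>0 < L\<close> by (simp add: top_ennreal.rep_eq top_ereal_def)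
    qed
    then obtain \<pi> where "\<pi> \<in> couplings Q \<gamma>"
      "(\<integral>\<^sup>+ z. ennreal (dist (fst z) (snd z)) \<partial>\<pi>) < ennreal (t\<^sup>2 / L)"
      unfolding wasserstein1_def INF_less_iff by blast
    then have "(\<integral>x. f x \<partial>Q) - (\<integral>x. f x \<partial>\<gamma>) \<le> K * (t\<^sup>2 / L)"
      using f01 lip \<open>0 \<le> K\<close> \<open>0 < L\<close> by (intro expectation_diff_le_transport_cost) auto
    also have "\<dots> = K / L * t\<^sup>2" by simp
    \<comment> \<open>Here t <= 1 is used, so that both errors are linear in
      \<open>t\<close>.\<close>
    also have "\<dots> \<le> K / L * t"
      using t \<open>0 \<le> K\<close> \<open>0 < L\<close> by (intro mult_left_mono) (auto simp: power2_eq_square mult_left_le)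
    finally show ?thesis
      using 1 by (simp add: algebra_simps)
  qed
  \<comment> \<open>The limit is one-sided because \<open>bound\<close> holds only for positive
    \<open>t\<close> up to 1.\<close>
  have "((\<lambda>t. t * (K / L + 2)) \<longlongrightarrow> 0 * (K / L + 2)) (at_right 0)"
    by (intro tendsto_intros)
  moreover have "\<forall>\<^sub>F t in at_right 0. (\<integral>x. f x \<partial>Q) - (\<integral>x. f x \<partial>P) \<le> t * (K / L + 2)"
    unfolding eventually_at_right_field by (rule exI[of _ 1]) (auto intro: bound)
  ultimately have "(\<integral>x. f x \<partial>Q) - (\<integral>x. f x \<partial>P) \<le> 0 * (K / L + 2)"
    by (intro tendsto_lowerbound) auto
  then show ?thesis by simp
qed

section \<open>Lipschitz functions determine a probability measure\<close>

text \<open>As in the portmanteau theorem, indicators of closed sets are pointwise limits of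
  Lipschitz functions with values in [0, 1], and closed sets form a generating pi-system.\<close>

lemma prob_measure_eqI_Lipschitz:
  fixes P Q :: "'a :: metric_space measure"
  assumes P: "prob_space P" "sets P = sets borel" and Q: "prob_space Q" "sets Q = sets borel"
    and eq: "\<And>(f :: 'a \<Rightarrow> real) K. f \<in> borel_measurable borel \<Longrightarrow> 0 \<le> K \<Longrightarrow>
      (\<And>x. 0 \<le> f x \<and> f x \<le> 1) \<Longrightarrow> (\<And>x y. \<bar>f x - f y\<bar> \<le> K * dist x y) \<Longrightarrow>
      (\<integral>x. f x \<partial>Q) = (\<integral>x. f x \<partial>P)"
  shows "Q = P"
proof -
  interpret P: prob_space P by fact
  interpret Q: prob_space Q by fact
  have closed_eq: "emeasure Q C = emeasure P C" if C: "closed C" for C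
  \<comment> \<open>The empty set is separate: \<open>infdist\<close> to it is 0 by convention, so
    the functions below would be constantly 1.\<close>
  proof (cases "C = {}")
    case False
    \<comment> \<open>A tent that is 1 on \<open>C\<close>, vanishes at distance 1/n or more for
      positive \<open>n\<close>, and has Lipschitz constant \<open>n\<close>.\<close>
    define f where "f n x = max 0 (1 - real n * infdist x C)" for n x
    have f_meas[measurable]: "f n \<in> borel_measurable borel" for n
      unfolding f_def by (intro borel_measurable_continuous_onI continuous_intros)
    have f01: "0 \<le> f n x" "f n x \<le> 1" for n x
      by (auto simp: f_def infdist_nonneg)
    have lip: "\<bar>f n x - f n y\<bar> \<le> real n * dist x y" for n x y
    proof -
      have "\<bar>f n x - f n y\<bar> \<le> \<bar>real n * (infdist x C - infdist y C)\<bar>"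
        unfolding f_def by (auto simp: algebra_simps)
      also have "\<dots> \<le> real n * dist x y"
        by (simp add: abs_mult mult_left_mono infdist_triangle_abs)
      finally show ?thesis .
    qed
    have lim: "(\<lambda>n. f n x) \<longlonglongrightarrow> indicator C x" for x
    proof (cases "x \<in> C")
      case True
      then show ?thesis by (simp add: f_def)
    next
      case x: False
      \<comment> \<open>Closedness enters here: a point outside \<open>C\<close> has positive
        distance from it, so the tents eventually vanish there.\<close>
      then have pos: "0 < infdist x C"
        using C False by (intro infdist_pos_not_in_closed)
      then obtain m where m: "1 < real m * infdist x C"
        using reals_Archimedean3 by blast
      have "f n x = 0" if "m \<le> n" for n
        using m that mult_right_mono[of "real m" "real n" "infdist x C"]
        by (simp add: f_def infdist_nonneg max_absorb1)
      then have "\<forall>\<^sub>F n in sequentially. f n x = 0"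
        unfolding eventually_sequentially by blast
      then show ?thesis
        using x by (simp add: tendsto_eventually)
    qed
    have conv: "(\<lambda>n. \<integral>x. f n x \<partial>M) \<longlonglongrightarrow> measure M C"
      if "prob_space M" "sets M = sets borel" for M
    proof -
      interpret M: prob_space M by fact
      note [measurable_cong] = that(2)
      have "C \<in> sets M" using C that by simp
      have "(\<lambda>n. \<integral>x. f n x \<partial>M) \<longlonglongrightarrow> (\<integral>x. indicator C x \<partial>M)"
        using lim f01 \<open>C \<in> sets M\<close>
        by (intro integral_dominated_convergence[where w="\<lambda>_. 1"]) auto
      then show ?thesis
        using \<open>C \<in> sets M\<close> by (simp add: sets.Int_space_eq2)
    qed
    have "(\<integral>x. f n x \<partial>Q) = (\<integral>x. f n x \<partial>P)" for n
      by (rule eq[of _ "real n"]) (auto simp: f01 lip)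
    then have "measure Q C = measure P C"
      using conv[OF P] conv[OF Q] by (metis (no_types, lifting) LIMSEQ_unique ext)
    then show ?thesis
      by (simp add: P.emeasure_eq_measure Q.emeasure_eq_measure)
  qed simp
  have borel: "sets (borel :: 'a measure) = sigma_sets UNIV (Collect closed)"
    by (simp add: borel_eq_closed)
  show ?thesis
  \<comment> \<open>The whole space is itself closed and of finite measure, so a constant sequence
    serves as the exhaustion.\<close>
  proof (rule measure_eqI_generator_eq[where A="\<lambda>_. UNIV" and \<Omega>=UNIV and E="Collect closed"])
    show "Int_stable (Collect closed :: 'a set set)"
      by (auto simp: Int_stable_def)
  qed (use closed_eq borel P Q in auto)
qed

lemma lip_KL_eq_0_iff:
  fixes P Q :: "(real ^ 'n) measure"
  assumes P: "P \<in> prob_measures" and Q: "Q \<in> prob_measures" and "0 < L"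
  shows "lip_KL L Q P = 0 \<longleftrightarrow> Q = P"
proof
  assume zero: "lip_KL L Q P = 0"
  interpret P: prob_space P using P by (simp add: prob_measures_def)
  interpret Q: prob_space Q using Q by (simp add: prob_measures_def)
  have [measurable_cong]: "sets P = sets borel" "sets Q = sets borel"
    using P Q by (auto simp: prob_measures_def)
  show "Q = P"
  proof (rule prob_measure_eqI_Lipschitz)
    fix f :: "real ^ 'n \<Rightarrow> real" and K
    assume f[measurable]: "f \<in> borel_measurable borel" and K: "0 \<le> K"
      and f01: "\<And>x. 0 \<le> f x \<and> f x \<le> 1" and lip: "\<And>x y. \<bar>f x - f y\<bar> \<le> K * dist x y"
    \<comment> \<open>The one-sided comparison is applied to f and to 1 - f; both have Lipschitz
      constant \<open>K\<close>.\<close>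
    have diff: "f x - f y \<le> K * dist x y" "1 - f x - (1 - f y) \<le> K * dist x y" for x y
      using lip[of x y] by auto
    have int: "integrable P f" "integrable Q f"
      using f01 by (auto intro!: P.integrable_const_bound[where B=1] Q.integrable_const_bound[where B=1])
    have "(\<integral>x. f x \<partial>Q) \<le> (\<integral>x. f x \<partial>P)"
      using f01 diff(1) K by (intro lip_KL_eq_0_imp_expectation_le[OF P \<open>0 < L\<close> zero]) auto
    moreover have "(\<integral>x. 1 - f x \<partial>Q) \<le> (\<integral>x. 1 - f x \<partial>P)"
      using f01 diff(2) K by (intro lip_KL_eq_0_imp_expectation_le[OF P \<open>0 < L\<close> zero, where K=K]) auto
    ultimately show "(\<integral>x. f x \<partial>Q) = (\<integral>x. f x \<partial>P)"
      using int by (simp add: P.prob_space Q.prob_space)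
  qed (use P Q in \<open>auto simp: prob_measures_def\<close>)
qed (use assms lip_KL_self[of P L] in auto)

theorem proposition2p2:
  fixes g :: "real ^ 'n \<Rightarrow> real" and \<alpha> l L :: real and P :: "(real ^ 'n) measure"
  assumes "g \<in> borel_measurable borel" and "\<And>x. 0 \<le> g x"
    and "0 < \<alpha>" and "\<alpha> < 1" and "0 < l" and "0 < L"
    and "P \<in> finite_risk g"
  shows "(\<forall>Q \<in> finite_risk g. finite_first_moment Q \<longrightarrow>
            0 \<le> loss g \<alpha> l L Q P \<and> (loss g \<alpha> l L Q P = 0 \<longleftrightarrow> Q = P)) \<and>
         (\<forall>Q \<in> finite_risk g. finite_first_moment Q \<longrightarrow>
            loss g \<alpha> l L P P \<le> loss g \<alpha> l L Q P \<and>
            (loss g \<alpha> l L Q P = loss g \<alpha> l L P P \<longrightarrow> Q = P)) \<and>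
         (finite_first_moment P \<longrightarrow>
            (\<forall>R. is_arg_min (\<lambda>Q. loss g \<alpha> l L Q P)
                   (\<lambda>Q. Q \<in> finite_risk g \<and> finite_first_moment Q) R \<longleftrightarrow> R = P))"
proof -
  have P: "P \<in> prob_measures"
    using \<open>P \<in> finite_risk g\<close> by (simp add: finite_risk_def)
  have square: "0 \<le> ereal (l * (CVaR \<alpha> P g - CVaR \<alpha> Q g)\<^sup>2)" for Q
    using \<open>0 < l\<close> by simp
  have nonneg: "0 \<le> loss g \<alpha> l L Q P" for Q
    unfolding loss_def using P \<open>0 < L\<close> square by (intro add_nonneg_nonneg lip_KL_nonneg) auto
  have eq: "loss g \<alpha> l L Q P = 0 \<longleftrightarrow> Q = P" if "Q \<in> finite_risk g" for Q
  proof
    assume "loss g \<alpha> l L Q P = 0"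
    \<comment> \<open>A sum of nonnegative extended reals vanishes only if each summand
      does.\<close>
    then have "lip_KL L Q P = 0"
      unfolding loss_def using lip_KL_nonneg[OF P, of L Q] square[of Q] \<open>0 < L\<close>
      by (metis add_nonneg_eq_0_iff less_imp_le)
    then show "Q = P"
      using lip_KL_eq_0_iff[of P Q L] P that \<open>0 < L\<close> by (simp add: finite_risk_def)
  next
    assume "Q = P"
    then show "loss g \<alpha> l L Q P = 0"
      using lip_KL_self[OF P, of L] \<open>0 < L\<close> by (simp add: loss_def)
  qed
  have pos: "0 < loss g \<alpha> l L Q P" if "Q \<in> finite_risk g" "Q \<noteq> P" for Q
    using nonneg[of Q] eq that by (simp add: less_le)
  have self: "loss g \<alpha> l L P P = 0"
    using eq[OF \<open>P \<in> finite_risk g\<close>] by simp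
  \<comment> \<open>The moment assumption makes \<open>P\<close> a feasible competitor of loss 0. A
    minimizer \<open>R\<close> then cannot have positive loss, and \<open>pos\<close> leaves only
    \<open>P\<close>.\<close>
  have "is_arg_min (\<lambda>Q. loss g \<alpha> l L Q P)
      (\<lambda>Q. Q \<in> finite_risk g \<and> finite_first_moment Q) R \<longleftrightarrow> R = P"
    if "finite_first_moment P" for R
  proof
    assume R: "is_arg_min (\<lambda>Q. loss g \<alpha> l L Q P)
      (\<lambda>Q. Q \<in> finite_risk g \<and> finite_first_moment Q) R"
    then have "\<not> 0 < loss g \<alpha> l L R P"
      using self that \<open>P \<in> finite_risk g\<close> unfolding is_arg_min_def by metis
    then show "R = P"
      using R pos unfolding is_arg_min_def by blast
  qed (use that nonneg self \<open>P \<in> finite_risk g\<close> in \<open>simp add: is_arg_min_def not_less\<close>)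
  then show ?thesis
    using nonneg eq self by simp
qed

end
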